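(* For every $\gamma>0$ there is a constant $\kappa_\gamma>0$ depending on $\gamma$ only such that the following holds for every integer $n\ge2$ with $\gamma\in\left(0,\frac{n}{\ln n}\right)$ and every $\epsilon>0$. Put $$t=\left\lceil\kappa_\gamma n^{2\gamma}\sqrt{\ln n}\left(n\ln n+\ln\frac1\epsilon\right)\right\rceil$$ and let $\mathbb{H}_1^n(\gamma,\epsilon)=\{\mathbf{z}_1,\mathbf{z}_2,\dots,\mathbf{z}_t\}$, where $\mathbf{z}_1,\dots,\mathbf{z}_t$ are i.i.d. uniform on $\mathbb{S}^n$. Then $$\operatorname{Prob}\left\{\mathbb{H}_1^n(\gamma,\epsilon)\in\mathbb{T}\left(n,\sqrt{\frac{\gamma\ln n}{2n}},t\right)\right\}\ge1-\epsilon.$$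
   Context: $\mathbb{S}^n=\{\mathbf{x}\in\mathbb{R}^n:\|\mathbf{x}\|=1\}$ is the Euclidean unit sphere in $\mathbb{R}^n$. For $\mathbf{v}\in\mathbb{S}^n$ and $-1\le\tau\le1$ let $\mathbb{B}^n(\mathbf{v},\tau)=\{\mathbf{x}\in\mathbb{S}^n:\mathbf{x}^{\rm T}\mathbf{v}\ge\tau\}$. A finite set $\mathbb{H}^n\subseteq\mathbb{S}^n$ is a $\tau$-hitting set if $\bigcup_{\mathbf{v}\in\mathbb{H}^n}\mathbb{B}^n(\mathbf{v},\tau)=\mathbb{S}^n$; $\mathbb{T}(n,\tau,m)$ is the collection of all $\tau$-hitting sets of $\mathbb{S}^n$ with at most $m$ elements. *)

theory Defs
  imports "HOL-Probability.Probability"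
begin

text \<open>
  The dimension \<open>n\<close> is quantified inside the theorem (after the constant depending on \<open>\<gamma>\<close>), so
  \<open>\<real>\<^sup>n\<close> cannot be type-indexed: a vector is a function in \<open>extensional {..<n}\<close>, i.e. a point of
  \<open>space (\<Pi>\<^sub>M i\<in>{..<n}. lborel)\<close>, which is \<open>\<real>\<^sup>n\<close> with its Borel sets and Lebesgue measure.
\<close>

abbreviation lebesgue_n :: "nat \<Rightarrow> (nat \<Rightarrow> real) measure" where
  "lebesgue_n n \<equiv> \<Pi>\<^sub>M i\<in>{..<n}. lborel"

definition inner_n :: "nat \<Rightarrow> (nat \<Rightarrow> real) \<Rightarrow> (nat \<Rightarrow> real) \<Rightarrow> real" where
  "inner_n n x y = (\<Sum>i<n. x i * y i)"

definition norm_n :: "nat \<Rightarrow> (nat \<Rightarrow> real) \<Rightarrow> real" where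
  "norm_n n x = sqrt (\<Sum>i<n. (x i)\<^sup>2)"

definition unit_ball :: "nat \<Rightarrow> (nat \<Rightarrow> real) set" where
  "unit_ball n = {x \<in> extensional {..<n}. norm_n n x \<le> 1}"

definition unit_sphere :: "nat \<Rightarrow> (nat \<Rightarrow> real) set" where
  "unit_sphere n = {x \<in> extensional {..<n}. norm_n n x = 1}"

definition sphere_cap :: "nat \<Rightarrow> (nat \<Rightarrow> real) \<Rightarrow> real \<Rightarrow> (nat \<Rightarrow> real) set" where
  "sphere_cap n v \<tau> = {x \<in> unit_sphere n. inner_n n x v \<ge> \<tau>}"

definition hitting_set :: "nat \<Rightarrow> real \<Rightarrow> (nat \<Rightarrow> real) set \<Rightarrow> bool" where
  "hitting_set n \<tau> H \<longleftrightarrow>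
     finite H \<and> H \<subseteq> unit_sphere n \<and> (\<Union>v\<in>H. sphere_cap n v \<tau>) = unit_sphere n"

definition hitting_sets :: "nat \<Rightarrow> real \<Rightarrow> nat \<Rightarrow> (nat \<Rightarrow> real) set set" where
  "hitting_sets n \<tau> m = {H. hitting_set n \<tau> H \<and> card H \<le> m}"

text \<open>
  The uniform distribution on the sphere (normalised surface measure), realised as the law of
  \<open>x / \<parallel>x\<parallel>\<close> for \<open>x\<close> uniform in the unit ball. It lives on all of \<open>\<real>\<^sup>n\<close> and is concentrated on the
  sphere; the projection sends only the null set \<open>{0}\<close> elsewhere.
\<close>

definition radial_proj :: "nat \<Rightarrow> (nat \<Rightarrow> real) \<Rightarrow> nat \<Rightarrow> real" where
  "radial_proj n x = (\<lambda>i\<in>{..<n}. x i / norm_n n x)"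

definition uniform_sphere :: "nat \<Rightarrow> (nat \<Rightarrow> real) measure" where
  "uniform_sphere n = distr (uniform_measure (lebesgue_n n) (unit_ball n)) (lebesgue_n n) (radial_proj n)"

text \<open>
  The joint law of \<open>z\<^sub>1, \<dots>, z\<^sub>t\<close> i.i.d. uniform on the sphere. By lemma \<open>iid_uniform_law\<close> below,
  every i.i.d. uniform family, on whatever probability space, has this law.
\<close>

definition iid_uniform :: "nat \<Rightarrow> nat \<Rightarrow> (nat \<Rightarrow> nat \<Rightarrow> real) measure" where
  "iid_uniform n t = (\<Pi>\<^sub>M i\<in>{1..t}. uniform_sphere n)"

text \<open>
  The sample size. For \<open>\<epsilon> > 1\<close> the ceiling may be negative; the coercion to \<open>nat\<close> then gives
  the empty sample.
\<close>

definition sample_size :: "real \<Rightarrow> real \<Rightarrow> nat \<Rightarrow> real \<Rightarrow> nat" where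
  "sample_size \<kappa> \<gamma> n \<epsilon> =
     nat \<lceil>\<kappa> * real n powr (2 * \<gamma>) * sqrt (ln (real n)) * (real n * ln (real n) + ln (1 / \<epsilon>))\<rceil>"

lemma norm_n_measurable [measurable]: "norm_n n \<in> borel_measurable (lebesgue_n n)"
  unfolding norm_n_def by measurable

lemma unit_ball_sets [measurable]: "unit_ball n \<in> sets (lebesgue_n n)"
proof -
  have "unit_ball n = {x \<in> space (lebesgue_n n). norm_n n x \<le> 1}"
    by (auto simp: unit_ball_def space_PiM PiE_def)
  then show ?thesis by simp
qed

lemma unit_sphere_sets [measurable]: "unit_sphere n \<in> sets (lebesgue_n n)"
proof -
  have "unit_sphere n = {x \<in> space (lebesgue_n n). norm_n n x = 1}"
    by (auto simp: unit_sphere_def space_PiM PiE_def)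
  then show ?thesis by simp
qed

lemma radial_proj_measurable [measurable]: "radial_proj n \<in> measurable (lebesgue_n n) (lebesgue_n n)"
  unfolding radial_proj_def by (rule measurable_restrict) measurable

lemma sets_uniform_sphere [simp, measurable_cong]: "sets (uniform_sphere n) = sets (lebesgue_n n)"
  by (simp add: uniform_sphere_def)

lemma emeasure_unit_ball:
  assumes "n \<ge> 1"
  shows "emeasure (lebesgue_n n) (unit_ball n) \<noteq> 0" "emeasure (lebesgue_n n) (unit_ball n) \<noteq> \<infinity>"
proof -
  interpret P: product_sigma_finite "\<lambda>_::nat. lborel :: real measure"
    by standard
  have box: "emeasure (lebesgue_n n) (\<Pi>\<^sub>E i\<in>{..<n}. {-c..c}) = ennreal ((2 * c) ^ n)" if "c \<ge> 0" for c :: real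
    using that by (subst P.emeasure_PiM) (auto simp: prod_ennreal ennreal_power)
  have boxs: "(\<Pi>\<^sub>E i\<in>{..<n}. {-c..c}) \<in> sets (lebesgue_n n)" for c :: real
    by (rule sets_PiM_I_finite) auto
  have "(\<Pi>\<^sub>E i\<in>{..<n}. {-(1 / n)..1 / n}) \<subseteq> unit_ball n"
  proof
    fix x assume x: "x \<in> (\<Pi>\<^sub>E i\<in>{..<n}. {-(1 / real n)..1 / real n})"
    have "(\<Sum>i<n. (x i)\<^sup>2) \<le> (\<Sum>i<n. 1 / real n)"
    proof (rule sum_mono)
      fix i assume "i \<in> {..<n}"
      then have "-(1 / real n) \<le> x i \<and> x i \<le> 1 / real n" using x by (auto simp: PiE_iff)
      then have "\<bar>x i\<bar> \<le> 1 / real n" by linarith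
      moreover have "1 / real n \<le> 1" using assms by simp
      ultimately have "\<bar>x i\<bar>\<^sup>2 \<le> 1 / real n * 1"
        unfolding power2_eq_square by (intro mult_mono) auto
      then show "(x i)\<^sup>2 \<le> 1 / real n" by simp
    qed
    then have "(\<Sum>i<n. (x i)\<^sup>2) \<le> 1" using assms by simp
    then show "x \<in> unit_ball n" using x by (auto simp: unit_ball_def norm_n_def PiE_iff)
  qed
  then have "ennreal ((2 * (1 / n)) ^ n) \<le> emeasure (lebesgue_n n) (unit_ball n)"
    using emeasure_mono[OF _ unit_ball_sets, of "\<Pi>\<^sub>E i\<in>{..<n}. {-(1 / n)..1 / n}" n] box[of "1 / n"]
    by simp
  moreover have "ennreal ((2 * (1 / n)) ^ n) > 0" using assms by simp
  ultimately show "emeasure (lebesgue_n n) (unit_ball n) \<noteq> 0" by auto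
  have "unit_ball n \<subseteq> (\<Pi>\<^sub>E i\<in>{..<n}. {-1..1})"
  proof
    fix x assume x: "x \<in> unit_ball n"
    have "\<bar>x i\<bar> \<le> 1" if "i < n" for i
    proof -
      have "(x i)\<^sup>2 \<le> (\<Sum>i<n. (x i)\<^sup>2)" by (rule member_le_sum) (use that in auto)
      also have "\<dots> \<le> 1" using x by (simp add: unit_ball_def norm_n_def)
      finally show ?thesis by (simp add: abs_square_le_1)
    qed
    then show "x \<in> (\<Pi>\<^sub>E i\<in>{..<n}. {-1..1})"
      using x by (force simp: unit_ball_def PiE_iff abs_le_iff)
  qed
  then have "emeasure (lebesgue_n n) (unit_ball n) \<le> ennreal ((2 * 1) ^ n)"
    using emeasure_mono[OF _ boxs[of 1]] unfolding box[of 1, OF zero_le_one, symmetric] by simp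
  then show "emeasure (lebesgue_n n) (unit_ball n) \<noteq> \<infinity>" 
    by (auto simp: top_unique)
qed

lemma prob_space_uniform_sphere:
  assumes "n \<ge> 1"
  shows "prob_space (uniform_sphere n)"
proof -
  interpret prob_space "uniform_measure (lebesgue_n n) (unit_ball n)"
    using emeasure_unit_ball[OF assms] by (rule prob_space_uniform_measure)
  show ?thesis unfolding uniform_sphere_def by (rule prob_space_distr) simp
qed

lemma iid_uniform_law:
  assumes "prob_space M"
    and "prob_space.indep_vars M (\<lambda>_. uniform_sphere n) z {1..t}"
    and "\<And>i. i \<in> {1..t} \<Longrightarrow> distr M (uniform_sphere n) (z i) = uniform_sphere n"
    and "t \<ge> 1"
  shows "distr M (iid_uniform n t) (\<lambda>\<omega>. \<lambda>i\<in>{1..t}. z i \<omega>) = iid_uniform n t"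
proof -
  interpret prob_space M by fact
  have rv: "random_variable (uniform_sphere n) (z i)" if "i \<in> {1..t}" for i
    using assms(2) that by (auto simp: indep_vars_def)
  have "distr M (iid_uniform n t) (\<lambda>\<omega>. \<lambda>i\<in>{1..t}. z i \<omega>)
      = (\<Pi>\<^sub>M i\<in>{1..t}. distr M (uniform_sphere n) (z i))"
    unfolding iid_uniform_def
    using indep_vars_iff_distr_eq_PiM'[of "{1..t}" z "\<lambda>_. uniform_sphere n"] rv assms(2,4) by simp
  also have "\<dots> = iid_uniform n t"
    unfolding iid_uniform_def by (rule PiM_cong) (use assms(3) in auto)
  finally show ?thesis .
qed

end

theory Submission
  imports Defs
begin

text \<open>
  The proof is a union bound over a net. Let \<open>\<tau> = sqrt (\<gamma> * ln n / (2 * n))\<close> and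
  \<open>\<eta> = 1 / (10 * sqrt n)\<close>. A grid gives an \<open>\<eta>\<close>-net of the sphere with at most
  \<open>(20 * n + 1) ^ n \<le> exp (6 * n * ln n)\<close> points (\<open>sphere_net_exists\<close>, \<open>grid_count_le\<close>). If every net
  point has a sample point in its cap at the slightly larger height \<open>\<tau> + \<eta>\<close>, then the sample is
  \<open>\<tau>\<close>-hitting. When each such cap has measure at least \<open>p\<close>, a fixed net point is missed by
  all \<open>t\<close> samples with probability at most \<open>(1 - p) ^ t \<le> exp (- p * t)\<close>, so the failure probability is at
  most \<open>exp (6 * n * ln n - p * t)\<close> (\<open>prob_hitting_ge\<close>). With \<open>p = n powr (- 2 * \<gamma>) / 60\<close>
  (\<open>measure_sphere_cap_threshold_ge\<close>) the sample size is chosen to make this at most \<open>\<epsilon>\<close>.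

  The cap bound comes from volumes. The measure of a cap is the proportion of the unit ball filled by
  its cone, and the cone contains a cylinder over an \<open>(n - 1)\<close>-dimensional ball, so that
  \<open>measure_sphere_cap_ge\<close> bounds the cap from below by
  \<open>h * sqrt (n / (2 * pi)) * sqrt (1 - (s + h)\<^sup>2) ^ (n - 1)\<close>. With the height \<open>h\<close> of the cylinder of
  order \<open>1 / sqrt n\<close> the first two factors are bounded below by a constant, because the volumes of unit balls in
  consecutive dimensions differ by a factor of order \<open>sqrt n\<close> (\<open>unit_ball_vol_ratio\<close>). The last
  factor decays like a power of \<open>n\<close>, as \<open>(s + h)\<^sup>2\<close> is of order \<open>ln n / n\<close>.

  Two points need care. The cylinder is computed for a cap centred on the first axis, and
  other centres are moved there by a reflection; a reflection preserves Lebesgue measure on the product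
  space by the uniqueness argument for Haar measure (\<open>distr_lebesgue_n_isometry\<close>). And the hitting event is an
  uncountable intersection, whose measurability rests on the continuity of the inner product
  (\<open>hitting_event_measurable\<close>).
\<close>

section \<open>Vectors as extensional functions\<close>

definition plus_n :: "nat \<Rightarrow> (nat \<Rightarrow> real) \<Rightarrow> (nat \<Rightarrow> real) \<Rightarrow> nat \<Rightarrow> real" where
  "plus_n n x y = (\<lambda>i\<in>{..<n}. x i + y i)"

definition minus_n :: "nat \<Rightarrow> (nat \<Rightarrow> real) \<Rightarrow> (nat \<Rightarrow> real) \<Rightarrow> nat \<Rightarrow> real" where
  "minus_n n x y = (\<lambda>i\<in>{..<n}. x i - y i)"

lemma plus_n_apply: "plus_n n x y i = (if i < n then x i + y i else undefined)"
  by (simp add: plus_n_def)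

lemma minus_n_apply: "minus_n n x y i = (if i < n then x i - y i else undefined)"
  by (simp add: minus_n_def)

lemma norm_n_L2_set: "norm_n n x = L2_set x {..<n}"
  by (simp add: norm_n_def L2_set_def)

lemma norm_n_nonneg [simp]: "norm_n n x \<ge> 0"
  by (simp add: norm_n_def sum_nonneg)

lemma norm_n_square: "(norm_n n x)\<^sup>2 = inner_n n x x"
  by (simp add: norm_n_def inner_n_def sum_nonneg power2_eq_square)

lemma inner_n_le_norm_n: "\<bar>inner_n n x y\<bar> \<le> norm_n n x * norm_n n y"
proof -
  have "\<bar>inner_n n x y\<bar> \<le> (\<Sum>i<n. \<bar>x i\<bar> * \<bar>y i\<bar>)"
    unfolding inner_n_def abs_mult [symmetric] by (rule sum_abs)
  also have "\<dots> \<le> norm_n n x * norm_n n y"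
    unfolding norm_n_L2_set by (rule L2_set_mult_ineq)
  finally show ?thesis .
qed

lemma inner_n_commute: "inner_n n x y = inner_n n y x"
  by (simp add: inner_n_def mult.commute)

lemma inner_n_minus_left: "inner_n n (minus_n n x y) z = inner_n n x z - inner_n n y z"
  by (simp add: inner_n_def minus_n_def left_diff_distrib sum_subtractf)

lemma norm_n_minus_commute: "norm_n n (minus_n n x y) = norm_n n (minus_n n y x)"
  by (simp add: norm_n_def minus_n_def power2_commute)

lemma space_lebesgue_n: "space (lebesgue_n n) = extensional {..<n}"
  by (simp add: space_PiM PiE_def)

lemma minus_n_extensional [simp]: "minus_n n x y \<in> extensional {..<n}"
  by (simp add: minus_n_def)

lemma minus_plus_n [simp]: "x \<in> extensional {..<n} \<Longrightarrow> minus_n n (plus_n n x y) y = x"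
  by (auto simp: minus_n_def plus_n_def extensional_def)

lemma plus_n_commute: "plus_n n x y = plus_n n y x"
  by (auto simp: plus_n_def add.commute)

lemma component_measurable:
  assumes "h \<in> measurable M (lebesgue_n n)" "i < n"
  shows "(\<lambda>w. h w i) \<in> borel_measurable M"
  using measurable_compose[OF assms(1) measurable_component_singleton[of i "{..<n}" "\<lambda>_. lborel"]] assms(2)
  by simp

lemma inner_n_measurable [measurable (raw)]:
  assumes "f \<in> measurable M (lebesgue_n n)" "g \<in> measurable M (lebesgue_n n)"
  shows "(\<lambda>w. inner_n n (f w) (g w)) \<in> borel_measurable M"
  using component_measurable[OF assms(1)] component_measurable[OF assms(2)] unfolding inner_n_def
  by (intro borel_measurable_sum borel_measurable_times) auto

lemma plus_n_measurable [measurable (raw)]: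
  assumes "f \<in> measurable M (lebesgue_n n)" "g \<in> measurable M (lebesgue_n n)"
  shows "(\<lambda>w. plus_n n (f w) (g w)) \<in> measurable M (lebesgue_n n)"
  using component_measurable[OF assms(1)] component_measurable[OF assms(2)] unfolding plus_n_def
  by (intro measurable_restrict) (auto intro!: borel_measurable_add)

lemma minus_n_measurable [measurable (raw)]:
  assumes "f \<in> measurable M (lebesgue_n n)" "g \<in> measurable M (lebesgue_n n)"
  shows "(\<lambda>w. minus_n n (f w) (g w)) \<in> measurable M (lebesgue_n n)"
  using component_measurable[OF assms(1)] component_measurable[OF assms(2)] unfolding minus_n_def
  by (intro measurable_restrict) (auto intro!: borel_measurable_diff)

section \<open>Rotation invariance of Lebesgue measure\<close>

lemma distr_lebesgue_n_plus:
  assumes a: "a \<in> extensional {..<n}"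
  shows "distr (lebesgue_n n) (lebesgue_n n) (\<lambda>x. plus_n n x a) = lebesgue_n n"
proof -
  interpret P: product_sigma_finite "\<lambda>_::nat. lborel :: real measure"
    by standard
  have aM: "a \<in> space (lebesgue_n n)" using a by (simp add: space_lebesgue_n)
  have m: "(\<lambda>x. plus_n n x a) \<in> measurable (lebesgue_n n) (lebesgue_n n)"
    using aM by measurable
  show ?thesis
  proof (rule P.PiM_eqI)
    fix A :: "nat \<Rightarrow> real set" assume A: "\<And>i. i \<in> {..<n} \<Longrightarrow> A i \<in> sets lborel"
    have A': "(\<lambda>y. y + a i) -` A i \<in> sets lborel" if "i \<in> {..<n}" for i
    proof -
      have "(\<lambda>y. y + a i) \<in> measurable lborel lborel" by measurable
      from measurable_sets[OF this A[OF that]] show ?thesis by (simp only: space_lborel space_borel Int_UNIV_right)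
    qed
    have "emeasure (distr (lebesgue_n n) (lebesgue_n n) (\<lambda>x. plus_n n x a)) (Pi\<^sub>E {..<n} A)
        = emeasure (lebesgue_n n) ((\<lambda>x. plus_n n x a) -` Pi\<^sub>E {..<n} A \<inter> space (lebesgue_n n))"
      using A by (intro emeasure_distr m sets_PiM_I_finite) auto
    also have "(\<lambda>x. plus_n n x a) -` Pi\<^sub>E {..<n} A \<inter> space (lebesgue_n n)
        = Pi\<^sub>E {..<n} (\<lambda>i. (\<lambda>y. y + a i) -` A i)"
      by (rule set_eqI) (simp add: space_lebesgue_n plus_n_def PiE_iff)
    also have "emeasure (lebesgue_n n) \<dots> = (\<Prod>i<n. emeasure lborel ((\<lambda>y. y + a i) -` A i))"
      using A' by (intro P.emeasure_PiM) auto
    also have "\<dots> = (\<Prod>i<n. emeasure lborel (A i))"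
    proof (rule prod.cong)
      fix i assume i: "i \<in> {..<n}"
      have "emeasure lborel (A i) = emeasure (distr lborel borel ((+) (a i))) (A i)"
        by (simp add: lborel_distr_plus)
      also have "\<dots> = emeasure lborel ((\<lambda>y. y + a i) -` A i)"
        using A[OF i] by (subst emeasure_distr) (simp_all add: vimage_def add.commute)
      finally show "emeasure lborel ((\<lambda>y. y + a i) -` A i) = emeasure lborel (A i)" ..
    qed simp
    finally show "emeasure (distr (lebesgue_n n) (lebesgue_n n) (\<lambda>x. plus_n n x a)) (Pi\<^sub>E {..<n} A)
      = (\<Prod>i<n. emeasure lborel (A i))" .
  qed auto
qed

lemma nn_integral_lebesgue_n_plus:
  assumes "a \<in> extensional {..<n}" and "f \<in> borel_measurable (lebesgue_n n)"
  shows "(\<integral>\<^sup>+x. f (plus_n n x a) \<partial>lebesgue_n n) = (\<integral>\<^sup>+x. f x \<partial>lebesgue_n n)"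
proof -
  have "a \<in> space (lebesgue_n n)" using assms by (simp add: space_lebesgue_n)
  then have m: "(\<lambda>x. plus_n n x a) \<in> measurable (lebesgue_n n) (lebesgue_n n)" by measurable
  have "(\<integral>\<^sup>+x. f x \<partial>lebesgue_n n) = (\<integral>\<^sup>+x. f x \<partial>distr (lebesgue_n n) (lebesgue_n n) (\<lambda>x. plus_n n x a))"
    by (simp only: distr_lebesgue_n_plus[OF assms(1)])
  also have "\<dots> = (\<integral>\<^sup>+x. f (plus_n n x a) \<partial>lebesgue_n n)"
    using m assms(2) by (simp add: nn_integral_distr)
  finally show ?thesis ..
qed

lemma emeasure_unit_ball_translate:
  assumes a: "a \<in> extensional {..<n}"
  shows "(\<integral>\<^sup>+x. indicator (unit_ball n) (minus_n n x a) \<partial>lebesgue_n n) = emeasure (lebesgue_n n) (unit_ball n)"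
proof -
  have "a \<in> space (lebesgue_n n)" using assms by (simp add: space_lebesgue_n)
  then have m: "(\<lambda>x. minus_n n x a) \<in> measurable (lebesgue_n n) (lebesgue_n n)" by measurable
  have "(\<integral>\<^sup>+x. indicator (unit_ball n) (minus_n n x a) \<partial>lebesgue_n n)
      = (\<integral>\<^sup>+x. indicator (unit_ball n) (minus_n n (plus_n n x a) a) \<partial>lebesgue_n n)"
    by (rule nn_integral_lebesgue_n_plus[symmetric, OF a]) (use m in measurable)
  also have "\<dots> = (\<integral>\<^sup>+x. indicator (unit_ball n) x \<partial>lebesgue_n n)"
    by (intro nn_integral_cong) (simp add: space_lebesgue_n)
  finally show ?thesis by simp
qed

text \<open>
  This is uniqueness of Haar measure, with the image measure \<open>\<mu>\<close> of \<open>T\<close> in the role of the second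
  translation invariant measure and the unit ball \<open>B\<close> as test set. Substituting translations under
  the double integral of \<open>1\<^sub>B(y) 1\<^sub>E(T x)\<close> and exchanging the order of integration turns
  \<open>\<lambda>(B) \<mu>(E)\<close> into the integral of \<open>1\<^sub>E(y) \<lambda>{x. y - T x \<in> B}\<close> over \<open>y\<close>. As \<open>T\<close> is a norm preserving involution, the inner
  set is a translate of \<open>B\<close>, so this integral is \<open>\<lambda>(B) \<lambda>(E)\<close>, and the positive finite factor
  \<open>\<lambda>(B)\<close> cancels. Writing \<open>\<mu>\<close> as a \<open>\<lambda>\<close>-integral throughout means that Fubini is applied only to \<open>\<lambda>\<close>.
\<close>

lemma distr_lebesgue_n_isometry:
  assumes n: "n \<ge> 1"
    and T [measurable]: "T \<in> measurable (lebesgue_n n) (lebesgue_n n)"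
    and plus: "\<And>x y. T (plus_n n x y) = plus_n n (T x) (T y)"
    and minus: "\<And>x y. T (minus_n n x y) = minus_n n (T x) (T y)"
    and norm: "\<And>x. norm_n n (T x) = norm_n n x"
    and inv: "\<And>x. x \<in> extensional {..<n} \<Longrightarrow> T (T x) = x"
  shows "distr (lebesgue_n n) (lebesgue_n n) T = lebesgue_n n"
proof (rule measure_eqI)
  let ?L = "lebesgue_n n" and ?B = "unit_ball n"
  fix E assume "E \<in> sets (distr ?L ?L T)"
  then have [measurable]: "E \<in> sets ?L" by simp
  interpret P: product_sigma_finite "\<lambda>_::nat. lborel :: real measure" by standard
  interpret F: finite_product_sigma_finite "\<lambda>_::nat. lborel :: real measure" "{..<n}" by standard auto
  interpret pair_sigma_finite ?L ?L by standard
  have ext: "T x \<in> extensional {..<n}" if "x \<in> space ?L" for x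
    using measurable_space[OF T that] by (simp add: space_lebesgue_n)
  have "emeasure ?L ?B * emeasure (distr ?L ?L T) E
      = (\<integral>\<^sup>+y. indicator ?B y * (\<integral>\<^sup>+x. indicator E (T x) \<partial>?L) \<partial>?L)"
    using nn_integral_distr[OF T, of "indicator E"] by (simp add: nn_integral_multc)
  also have "\<dots> = (\<integral>\<^sup>+y. (\<integral>\<^sup>+x. indicator ?B y * indicator E (plus_n n (T x) y) \<partial>?L) \<partial>?L)"
  proof (rule nn_integral_cong)
    fix y assume y: "y \<in> space ?L"
    (* translating x by T y moves T x by T (T y) = y *)
    have "(\<integral>\<^sup>+x. indicator E (T x) \<partial>?L) = (\<integral>\<^sup>+x. indicator E (T (plus_n n x (T y))) \<partial>?L)"
      by (rule nn_integral_lebesgue_n_plus[symmetric, OF ext[OF y]]) measurable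
    also have "\<dots> = (\<integral>\<^sup>+x. indicator E (plus_n n (T x) y) \<partial>?L)"
      using y by (simp add: plus inv space_lebesgue_n)
    finally show "indicator ?B y * (\<integral>\<^sup>+x. indicator E (T x) \<partial>?L)
        = (\<integral>\<^sup>+x. indicator ?B y * indicator E (plus_n n (T x) y) \<partial>?L)"
      using y by (subst nn_integral_cmult) (auto, measurable)
  qed
  also have "\<dots> = (\<integral>\<^sup>+x. (\<integral>\<^sup>+y. indicator ?B y * indicator E (plus_n n (T x) y) \<partial>?L) \<partial>?L)"
    by (rule Fubini') measurable
  also have "\<dots> = (\<integral>\<^sup>+x. (\<integral>\<^sup>+y. indicator ?B (minus_n n y (T x)) * indicator E y \<partial>?L) \<partial>?L)"
  proof (rule nn_integral_cong)
    fix x assume x: "x \<in> space ?L"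
    have Tx: "T x \<in> space ?L" using ext[OF x] by (simp add: space_lebesgue_n)
    have "(\<integral>\<^sup>+y. indicator ?B (minus_n n y (T x)) * indicator E y \<partial>?L)
       = (\<integral>\<^sup>+y. indicator ?B (minus_n n (plus_n n y (T x)) (T x)) * indicator E (plus_n n y (T x)) \<partial>?L)"
      by (rule nn_integral_lebesgue_n_plus[symmetric, OF ext[OF x]]) (use Tx in measurable)
    also have "\<dots> = (\<integral>\<^sup>+y. indicator ?B y * indicator E (plus_n n (T x) y) \<partial>?L)"
      by (intro nn_integral_cong) (simp add: space_lebesgue_n plus_n_commute)
    finally show "(\<integral>\<^sup>+y. indicator ?B y * indicator E (plus_n n (T x) y) \<partial>?L)
       = (\<integral>\<^sup>+y. indicator ?B (minus_n n y (T x)) * indicator E y \<partial>?L)" by (rule sym)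
  qed
  also have "\<dots> = (\<integral>\<^sup>+y. (\<integral>\<^sup>+x. indicator ?B (minus_n n y (T x)) * indicator E y \<partial>?L) \<partial>?L)"
    by (rule Fubini') measurable
  also have "\<dots> = (\<integral>\<^sup>+y. emeasure ?L ?B * indicator E y \<partial>?L)"
  proof (rule nn_integral_cong)
    fix y assume y: "y \<in> space ?L"
    have "norm_n n (minus_n n y (T x)) = norm_n n (minus_n n x (T y))" for x
    proof -
      have "norm_n n (minus_n n y (T x)) = norm_n n (T (minus_n n (T y) x))"
        using y by (simp add: minus inv space_lebesgue_n)
      then show ?thesis using norm_n_minus_commute by (simp add: norm)
    qed
    then have "(indicator ?B (minus_n n y (T x)) :: ennreal) = indicator ?B (minus_n n x (T y))" for x
      by (simp add: unit_ball_def indicator_def)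
    then show "(\<integral>\<^sup>+x. indicator ?B (minus_n n y (T x)) * indicator E y \<partial>?L) = emeasure ?L ?B * indicator E y"
      using emeasure_unit_ball_translate[OF ext[OF y]] measurable_space[OF T y]
      by (subst nn_integral_multc) (auto, measurable)
  qed
  also have "\<dots> = emeasure ?L ?B * emeasure ?L E"
    by (simp add: nn_integral_cmult)
  finally show "emeasure (distr ?L ?L T) E = emeasure ?L E"
    using emeasure_unit_ball[OF n] by (simp add: ennreal_mult_cancel_left)
qed simp

text \<open>
  The reflection in the hyperplane orthogonal to \<open>u\<close>. For \<open>u = 0\<close> the quotient is \<open>0\<close> and the map is the
  identity, which is what is wanted when the two vectors to be exchanged already agree.
\<close>

definition reflect_n :: "nat \<Rightarrow> (nat \<Rightarrow> real) \<Rightarrow> (nat \<Rightarrow> real) \<Rightarrow> nat \<Rightarrow> real" where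
  "reflect_n n u x = (\<lambda>i\<in>{..<n}. x i - 2 * inner_n n x u / inner_n n u u * u i)"

lemma reflect_n_apply:
  "reflect_n n u x i = (if i < n then x i - 2 * inner_n n x u / inner_n n u u * u i else undefined)"
  by (simp add: reflect_n_def)

lemma reflect_n_extensional [simp]: "reflect_n n u x \<in> extensional {..<n}"
  by (simp add: reflect_n_def)

lemma inner_n_reflect_left:
  "inner_n n (reflect_n n u x) y = inner_n n x y - 2 * inner_n n x u / inner_n n u u * inner_n n u y"
  by (simp add: inner_n_def reflect_n_def left_diff_distrib sum_subtractf sum_distrib_left mult.assoc)

lemma inner_n_reflect_right:
  "inner_n n x (reflect_n n u y) = inner_n n x y - 2 * inner_n n y u / inner_n n u u * inner_n n x u"
  by (subst (1 2 5) inner_n_commute) (rule inner_n_reflect_left)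

lemma inner_n_reflect_reflect:
  "inner_n n (reflect_n n u x) (reflect_n n u y) = inner_n n x y"
  by (cases "inner_n n u u = 0")
    (simp_all add: inner_n_reflect_left inner_n_reflect_right inner_n_commute[of n u y])

lemma norm_n_reflect: "norm_n n (reflect_n n u x) = norm_n n x"
  using inner_n_reflect_reflect[of n u x x]
  by (simp add: norm_n_square[symmetric])

lemma reflect_n_involution:
  assumes "x \<in> extensional {..<n}"
  shows "reflect_n n u (reflect_n n u x) = x"
proof
  fix i
  have "2 * inner_n n (reflect_n n u x) u / inner_n n u u = - (2 * inner_n n x u / inner_n n u u)"
    by (cases "inner_n n u u = 0") (simp_all add: inner_n_reflect_left field_simps)
  then show "reflect_n n u (reflect_n n u x) i = x i"
    using assms
    by (simp only: reflect_n_apply[of n u "reflect_n n u x"]) (simp add: reflect_n_apply extensional_def)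
qed

lemma reflect_n_plus: "reflect_n n u (plus_n n x y) = plus_n n (reflect_n n u x) (reflect_n n u y)"
proof -
  have "inner_n n (plus_n n x y) u = inner_n n x u + inner_n n y u"
    by (simp add: inner_n_def plus_n_def distrib_right sum.distrib)
  then show ?thesis
    by (intro ext) (simp add: reflect_n_apply plus_n_apply add_divide_distrib distrib_left distrib_right)
qed

lemma reflect_n_minus: "reflect_n n u (minus_n n x y) = minus_n n (reflect_n n u x) (reflect_n n u y)"
  by (intro ext)
    (simp add: reflect_n_apply minus_n_apply inner_n_minus_left diff_divide_distrib left_diff_distrib right_diff_distrib)

lemma reflect_n_measurable [measurable]: "reflect_n n u \<in> measurable (lebesgue_n n) (lebesgue_n n)"
  unfolding reflect_n_def inner_n_def by (rule measurable_restrict) measurable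

lemma distr_lebesgue_n_reflect:
  assumes "n \<ge> 1"
  shows "distr (lebesgue_n n) (lebesgue_n n) (reflect_n n u) = lebesgue_n n"
  using assms
  by (intro distr_lebesgue_n_isometry reflect_n_plus reflect_n_minus norm_n_reflect
      reflect_n_involution reflect_n_measurable)

section \<open>Volume of a spherical cap\<close>

definition axis_n :: "nat \<Rightarrow> nat \<Rightarrow> real" where
  "axis_n n = (\<lambda>i\<in>{..<n}. if i = 0 then 1 else 0)"

lemma inner_n_axis: "n \<ge> 1 \<Longrightarrow> inner_n n x (axis_n n) = x 0"
proof -
  assume "n \<ge> 1"
  have "inner_n n x (axis_n n) = (\<Sum>i<n. if i = 0 then x i else 0)"
    unfolding inner_n_def axis_n_def by (rule sum.cong) auto
  with \<open>n \<ge> 1\<close> show ?thesis by (simp add: sum.delta)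
qed

text \<open>
  Reflection in the perpendicular bisector of two unit vectors exchanges them; being self-adjoint,
  it turns the product with \<open>v\<close> into the first coordinate.
\<close>

lemma inner_n_reflect_to_axis:
  assumes n: "n \<ge> 1" and v: "v \<in> unit_sphere n"
  shows "reflect_n n (minus_n n v (axis_n n)) x 0 = inner_n n x v"
proof -
  define u where "u = minus_n n v (axis_n n)"
  have vv: "inner_n n v v = 1" using v by (simp add: norm_n_square[symmetric] unit_sphere_def)
  have e: "inner_n n (axis_n n) (axis_n n) = 1"
    using inner_n_axis[OF n] n by (simp add: axis_n_def)
  have xu: "inner_n n x u = inner_n n x v - inner_n n x (axis_n n)" for x
    using inner_n_minus_left[of n v "axis_n n" x] by (simp add: u_def inner_n_commute)
  have ux: "inner_n n u x = inner_n n v x - inner_n n (axis_n n) x" for x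
    by (simp add: u_def inner_n_minus_left)
  have uu: "inner_n n u u = 2 - 2 * inner_n n v (axis_n n)"
    by (simp add: ux xu vv e inner_n_commute[of n "axis_n n" v])
  have "inner_n n (reflect_n n u x) (axis_n n) = inner_n n x v"
  proof (cases "inner_n n u u = 0")
    case True
    then have "norm_n n u = 0" using norm_n_square[of n u] by simp
    then have "inner_n n x u = 0" using inner_n_le_norm_n[of n x u] by simp
    then show ?thesis using xu by (simp add: inner_n_reflect_left)
  next
    case False
    have "inner_n n u (axis_n n) = - inner_n n u u / 2"
      by (simp add: uu) (simp add: ux e)
    then have "2 * inner_n n x u / inner_n n u u * inner_n n u (axis_n n) = - inner_n n x u"
      using False by simp
    then show ?thesis using xu[of x] by (simp only: inner_n_reflect_left)
  qed
  then show ?thesis by (simp add: inner_n_axis[OF n] u_def)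
qed

lemma cone_sets:
  assumes "n \<ge> 1"
  shows "{x \<in> unit_ball n. norm_n n x \<noteq> 0 \<and> s * norm_n n x \<le> x 0} \<in> sets (lebesgue_n n)"
proof -
  have [measurable]: "(\<lambda>x. x 0) \<in> borel_measurable (lebesgue_n n)"
    using measurable_component_singleton[of 0 "{..<n}" "\<lambda>_. lborel :: real measure"] assms by simp
  have "{x \<in> space (lebesgue_n n). norm_n n x \<noteq> 0 \<and> s * norm_n n x \<le> x 0} \<in> sets (lebesgue_n n)"
    by (intro sets.sets_Collect_conj borel_measurable_neq borel_measurable_le) measurable
  then have "unit_ball n \<inter> {x \<in> space (lebesgue_n n). norm_n n x \<noteq> 0 \<and> s * norm_n n x \<le> x 0} \<in> sets (lebesgue_n n)"
    by (intro sets.Int unit_ball_sets)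
  also have "unit_ball n \<inter> {x \<in> space (lebesgue_n n). norm_n n x \<noteq> 0 \<and> s * norm_n n x \<le> x 0}
       = {x \<in> unit_ball n. norm_n n x \<noteq> 0 \<and> s * norm_n n x \<le> x 0}"
    by (auto simp: unit_ball_def space_lebesgue_n)
  finally show ?thesis .
qed

text \<open>
  The cone over a cap contains the cylinder \<open>s < x\<^sub>0 \<le> s + h\<close> whose base is the \<open>(n - 1)\<close>-dimensional
  ball of radius \<open>sqrt (1 - (s + h)\<^sup>2)\<close>: its points have norm at most \<open>1\<close>, hence
  \<open>s * norm_n n x \<le> s < x\<^sub>0\<close>. The strict inequality on the left keeps the origin out even when \<open>s = 0\<close>.
\<close>

lemma emeasure_cone_axis:
  assumes n: "n \<ge> 2" and s: "0 \<le> s" and h: "0 < h" and sh: "s + h < 1"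
  shows "emeasure (lebesgue_n n) {x \<in> unit_ball n. norm_n n x \<noteq> 0 \<and> s * norm_n n x \<le> x 0}
    \<ge> ennreal (h * (unit_ball_vol (real (n - 1)) * sqrt (1 - (s + h)\<^sup>2) ^ (n - 1)))"
proof -
  interpret P: product_sigma_finite "\<lambda>_::nat. lborel :: real measure" by standard
  define r where "r = sqrt (1 - (s + h)\<^sup>2)"
  define I where "I = {1..<n}"
  have I: "finite I" "0 \<notin> I" "insert 0 I = {..<n}" "card I = n - 1"
    using n by (auto simp: I_def)
  have "(s + h)\<^sup>2 < 1" using s h sh by (simp add: power_less_one_iff abs_square_less_1)
  then have r: "r > 0" by (simp add: r_def)
  define B where "B = {f. sqrt (\<Sum>i\<in>I. (f i)\<^sup>2) \<le> r} \<inter> space (Pi\<^sub>M I (\<lambda>_. lborel))"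
  have B: "B \<in> sets (Pi\<^sub>M I (\<lambda>_. lborel))"
    unfolding B_def by (simp add: Int_def conj_commute)
  define A where "A = {x \<in> space (lebesgue_n n). s < x 0 \<and> x 0 \<le> s + h \<and> sqrt (\<Sum>i\<in>I. (x i)\<^sup>2) \<le> r}"
  have meas: "(\<lambda>x. x i) \<in> borel_measurable (lebesgue_n n)" if "i < n" for i
    using measurable_component_singleton[of i "{..<n}" "\<lambda>_. lborel :: real measure"] that by simp
  have A: "A \<in> sets (lebesgue_n n)"
  proof -
    have [measurable]: "(\<lambda>x. x 0) \<in> borel_measurable (lebesgue_n n)" using n by (intro meas) auto
    have [measurable]: "(\<lambda>x. \<Sum>i\<in>I. (x i)\<^sup>2) \<in> borel_measurable (lebesgue_n n)"
      by (intro borel_measurable_sum borel_measurable_power meas) (auto simp: I_def)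
    show ?thesis unfolding A_def by measurable
  qed
  have split: "indicator A (x(0 := y)) = (indicator {s<..s+h} y * indicator B x :: ennreal)"
    if "x \<in> space (Pi\<^sub>M I (\<lambda>_. lborel))" for x y
  proof -
    have "x(0 := y) \<in> space (lebesgue_n n)"
      using that I by (auto simp: space_PiM PiE_def extensional_def I_def)
    moreover have "(\<Sum>i\<in>I. ((x(0 := y)) i)\<^sup>2) = (\<Sum>i\<in>I. (x i)\<^sup>2)"
      using I by (intro sum.cong) auto
    ultimately show ?thesis using that by (auto simp: A_def B_def indicator_def)
  qed
  have "emeasure (lebesgue_n n) A = (\<integral>\<^sup>+x. indicator A x \<partial>Pi\<^sub>M (insert 0 I) (\<lambda>_. lborel))"
    using A I by simp
  also have "\<dots> = (\<integral>\<^sup>+y. (\<integral>\<^sup>+x. indicator A (x(0 := y)) \<partial>Pi\<^sub>M I (\<lambda>_. lborel)) \<partial>lborel)"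
    using A I by (intro P.product_nn_integral_insert_rev) auto
  also have "\<dots> = (\<integral>\<^sup>+y. (\<integral>\<^sup>+x. indicator {s<..s+h} y * indicator B x \<partial>Pi\<^sub>M I (\<lambda>_. lborel)) \<partial>lborel)"
    by (intro nn_integral_cong split)
  also have "\<dots> = (\<integral>\<^sup>+y. indicator {s<..s+h} y * emeasure (Pi\<^sub>M I (\<lambda>_. lborel)) B \<partial>lborel)"
    using B by (simp add: nn_integral_cmult)
  also have "\<dots> = ennreal h * emeasure (Pi\<^sub>M I (\<lambda>_. lborel)) B"
    using h by (simp add: nn_integral_multc)
  also have "emeasure (Pi\<^sub>M I (\<lambda>_. lborel)) B = ennreal (unit_ball_vol (real (n - 1)) * r ^ (n - 1))"
    unfolding B_def using emeasure_cball_aux[OF I(1) r] I(4) by simp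
  also have "ennreal h * \<dots> = ennreal (h * (unit_ball_vol (real (n - 1)) * r ^ (n - 1)))"
    using h r by (simp add: ennreal_mult)
  finally have vol: "emeasure (lebesgue_n n) A = \<dots>" .
  have "A \<subseteq> {x \<in> unit_ball n. norm_n n x \<noteq> 0 \<and> s * norm_n n x \<le> x 0}"
  proof
    fix x assume x: "x \<in> A"
    have sq: "(\<Sum>i<n. (x i)\<^sup>2) = (x 0)\<^sup>2 + (\<Sum>i\<in>I. (x i)\<^sup>2)"
      unfolding I(3)[symmetric] using I(1,2) by simp
    have x0: "0 < x 0" using x s by (simp add: A_def)
    have "(x 0)\<^sup>2 \<le> (s + h)\<^sup>2" using x s by (intro power_mono) (auto simp: A_def)
    moreover have "(\<Sum>i\<in>I. (x i)\<^sup>2) \<le> 1 - (s + h)\<^sup>2"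
      using x by (simp add: A_def r_def)
    ultimately have le: "norm_n n x \<le> 1" by (simp add: norm_n_def sq)
    have pos: "norm_n n x \<noteq> 0"
    proof -
      have "0 < (x 0)\<^sup>2 + (\<Sum>i\<in>I. (x i)\<^sup>2)"
        using x0 by (intro add_pos_nonneg sum_nonneg) auto
      then show ?thesis by (simp add: norm_n_def sq)
    qed
    have "s * norm_n n x \<le> s * 1" using le s by (intro mult_left_mono) auto
    also have "\<dots> \<le> x 0" using x by (simp add: A_def)
    finally show "x \<in> {x \<in> unit_ball n. norm_n n x \<noteq> 0 \<and> s * norm_n n x \<le> x 0}"
      using le pos x by (simp add: unit_ball_def A_def space_lebesgue_n)
  qed
  then show ?thesis
    unfolding vol[symmetric, unfolded r_def] by (rule emeasure_mono) (use n in \<open>simp add: cone_sets\<close>)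
qed

text \<open>
  Log-convexity of \<open>Gamma\<close> at the midpoint of \<open>x\<close> and \<open>x + 1\<close>, combined with
  \<open>Gamma (x + 1) = x * Gamma x\<close>.
\<close>

lemma Gamma_half_step:
  fixes x :: real
  assumes x: "x > 0"
  shows "sqrt x * Gamma (x + 1 / 2) \<le> Gamma (x + 1)"
proof -
  have Gpos: "Gamma x > 0" "Gamma (x + 1/2) > 0" "Gamma (x + 1) > 0"
    using x by (auto intro!: Gamma_real_pos)
  have "(ln \<circ> Gamma) ((1 - 1/2) *\<^sub>R x + (1/2) *\<^sub>R (x + 1))
      \<le> (1 - 1/2) * (ln \<circ> Gamma) x + (1/2) * (ln \<circ> Gamma) (x + 1)"
    by (rule convex_onD[OF log_convex_Gamma_real]) (use x in auto)
  then have "2 * ln (Gamma (x + 1/2)) \<le> ln (Gamma x) + ln (Gamma (x + 1))"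
    by (simp add: field_simps)
  then have "ln ((Gamma (x + 1/2))\<^sup>2) \<le> ln (Gamma x * Gamma (x + 1))"
    using x Gpos by (simp add: ln_mult_pos ln_realpow)
  then have "(Gamma (x + 1/2))\<^sup>2 \<le> Gamma x * Gamma (x + 1)"
    using Gpos by (subst (asm) ln_le_cancel_iff) auto
  then have "x * (Gamma (x + 1/2))\<^sup>2 \<le> x * (Gamma x * Gamma (x + 1))"
    using x by (intro mult_left_mono) auto
  also have "\<dots> = (Gamma (x + 1))\<^sup>2"
    using x Gamma_plus1[of x] by (auto simp: power2_eq_square nonpos_Ints_def)
  finally have "(sqrt x * Gamma (x + 1/2))\<^sup>2 \<le> (Gamma (x + 1))\<^sup>2"
    using x by (simp add: power_mult_distrib)
  then show ?thesis by (rule power2_le_imp_le) (use Gpos in simp)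
qed

text \<open>
  Passing to the next dimension shrinks the unit ball by a factor of order \<open>1 / sqrt n\<close>. This gain
  compensates the height \<open>h\<close> of the cylinder when \<open>h\<close> is itself of order \<open>1 / sqrt n\<close>.
\<close>

lemma unit_ball_vol_ratio:
  assumes "n \<ge> 1"
  shows "unit_ball_vol (real n) * sqrt (real n / (2 * pi)) \<le> unit_ball_vol (real (n - 1))"
proof -
  define x where "x = real n / 2"
  have x: "x > 0" using assms by (simp add: x_def)
  have n1: "real (n - 1) / 2 = x - 1/2" using assms by (simp add: x_def of_nat_diff field_simps)
  have "pi powr x * sqrt (x / pi) = pi powr (x - 1/2) * sqrt x"
    by (simp add: powr_diff powr_half_sqrt real_sqrt_divide)
  moreover have "unit_ball_vol (real n) = pi powr x / Gamma (x + 1)"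
    by (simp add: unit_ball_vol_def x_def)
  moreover have "real n / (2 * pi) = x / pi"
    by (simp add: x_def)
  ultimately have "unit_ball_vol (real n) * sqrt (real n / (2 * pi)) = pi powr (x - 1/2) * (sqrt x / Gamma (x + 1))"
    by simp
  also have "\<dots> \<le> pi powr (x - 1/2) * (1 / Gamma (x + 1/2))"
    using Gamma_half_step[OF x] Gamma_real_pos[of "x + 1"] Gamma_real_pos[of "x + 1/2"] x
    by (intro mult_left_mono) (simp_all add: divide_simps mult.commute)
  also have "\<dots> = unit_ball_vol (real (n - 1))"
    unfolding unit_ball_vol_def n1 by (simp add: add.commute)
  finally show ?thesis .
qed

lemma sphere_cap_sets [measurable]: "v \<in> extensional {..<n} \<Longrightarrow> sphere_cap n v s \<in> sets (lebesgue_n n)"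
proof -
  assume "v \<in> extensional {..<n}"
  then have "v \<in> space (lebesgue_n n)" by (simp add: space_lebesgue_n)
  have "sphere_cap n v s = unit_sphere n \<inter> {x \<in> space (lebesgue_n n). s \<le> inner_n n x v}"
    by (auto simp: sphere_cap_def unit_sphere_def space_lebesgue_n)
  also have "\<dots> \<in> sets (lebesgue_n n)" using \<open>v \<in> space (lebesgue_n n)\<close> by measurable
  finally show ?thesis .
qed

lemma norm_n_radial_proj: "norm_n n x \<noteq> 0 \<Longrightarrow> norm_n n (radial_proj n x) = 1"
proof -
  assume nz: "norm_n n x \<noteq> 0"
  have "(\<Sum>i<n. (radial_proj n x i)\<^sup>2) = (\<Sum>i<n. (x i)\<^sup>2) / (norm_n n x)\<^sup>2"
    by (simp add: radial_proj_def power_divide sum_divide_distrib)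
  also have "(\<Sum>i<n. (x i)\<^sup>2) = (norm_n n x)\<^sup>2"
    by (simp add: norm_n_def sum_nonneg)
  finally show ?thesis using nz by (simp add: norm_n_def[of n "radial_proj n x"])
qed

lemma norm_n_radial_proj_0: "norm_n n x = 0 \<Longrightarrow> norm_n n (radial_proj n x) = 0"
  by (simp add: radial_proj_def norm_n_def[of n "radial_proj n x"])
    (simp add: norm_n_def)

lemma inner_n_radial_proj: "inner_n n (radial_proj n x) v = inner_n n x v / norm_n n x"
  by (simp add: inner_n_def radial_proj_def sum_divide_distrib)

lemma emeasure_uniform_sphere:
  assumes A: "A \<in> sets (lebesgue_n n)"
  shows "emeasure (uniform_sphere n) A
    = emeasure (lebesgue_n n) {x \<in> unit_ball n. radial_proj n x \<in> A} / emeasure (lebesgue_n n) (unit_ball n)"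
proof -
  have "emeasure (uniform_sphere n) A
    = emeasure (uniform_measure (lebesgue_n n) (unit_ball n)) (radial_proj n -` A \<inter> space (lebesgue_n n))"
    unfolding uniform_sphere_def using A by (subst emeasure_distr) (simp_all add: radial_proj_measurable)
  also have "\<dots> = emeasure (lebesgue_n n) (unit_ball n \<inter> (radial_proj n -` A \<inter> space (lebesgue_n n)))
     / emeasure (lebesgue_n n) (unit_ball n)"
    using measurable_sets[OF radial_proj_measurable A] by (intro emeasure_uniform_measure unit_ball_sets)
  also have "unit_ball n \<inter> (radial_proj n -` A \<inter> space (lebesgue_n n)) = {x \<in> unit_ball n. radial_proj n x \<in> A}"
    by (auto simp: unit_ball_def space_lebesgue_n)
  finally show ?thesis .
qed

lemma emeasure_lebesgue_n_unit_ball: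
  "emeasure (lebesgue_n n) (unit_ball n) = ennreal (unit_ball_vol (real n))"
proof -
  have "unit_ball n = {f. sqrt (\<Sum>i<n. (f i)\<^sup>2) \<le> 1} \<inter> space (lebesgue_n n)"
    by (auto simp: unit_ball_def norm_n_def space_lebesgue_n)
  then show ?thesis using emeasure_cball_aux[of "{..<n}" 1] by simp
qed

text \<open>
  Under the law of \<open>x / \<parallel>x\<parallel>\<close> the measure of a cap is the proportion of the ball that its cone fills;
  a reflection moves the centre of the cap to the first axis, where the cylinder bounds that volume.
\<close>

lemma measure_sphere_cap_ge:
  assumes n: "n \<ge> 2" and v: "v \<in> unit_sphere n" and s: "0 \<le> s" and h: "0 < h" and sh: "s + h < 1"
  shows "measure (uniform_sphere n) (sphere_cap n v s)
    \<ge> h * sqrt (real n / (2 * pi)) * sqrt (1 - (s + h)\<^sup>2) ^ (n - 1)"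
proof -
  interpret prob_space "uniform_sphere n" using n by (intro prob_space_uniform_sphere) simp
  define u where "u = minus_n n v (axis_n n)"
  let ?L = "lebesgue_n n" and ?C = "{x \<in> unit_ball n. norm_n n x \<noteq> 0 \<and> s * norm_n n x \<le> x 0}"
  let ?p = "h * sqrt (real n / (2 * pi)) * sqrt (1 - (s + h)\<^sup>2) ^ (n - 1)"
  have n1: "n \<ge> 1" using n by simp
  have ve: "v \<in> extensional {..<n}" using v by (simp add: unit_sphere_def)
  have C: "?C \<in> sets ?L" using n1 by (rule cone_sets)
  have sq: "0 \<le> sqrt (1 - (s + h)\<^sup>2)" 
    using s h sh by (simp add: abs_square_le_1)
  have "{x \<in> unit_ball n. radial_proj n x \<in> sphere_cap n v s}
     = {x \<in> unit_ball n. norm_n n x \<noteq> 0 \<and> s * norm_n n x \<le> inner_n n x v}"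
  proof (rule Collect_cong, rule conj_cong[OF refl])
    fix x
    have "radial_proj n x \<in> extensional {..<n}" by (simp add: radial_proj_def)
    then show "radial_proj n x \<in> sphere_cap n v s \<longleftrightarrow> norm_n n x \<noteq> 0 \<and> s * norm_n n x \<le> inner_n n x v"
      using norm_n_radial_proj[of n x] norm_n_radial_proj_0[of n x] norm_n_nonneg[of n x]
      by (cases "norm_n n x = 0")
        (simp_all add: sphere_cap_def unit_sphere_def inner_n_radial_proj pos_le_divide_eq less_le)
  qed
  also have "\<dots> = reflect_n n u -` ?C \<inter> space ?L"
    using inner_n_reflect_to_axis[OF n1 v]
    by (auto simp: u_def unit_ball_def norm_n_reflect space_lebesgue_n)
  finally have eq: "{x \<in> unit_ball n. radial_proj n x \<in> sphere_cap n v s} = reflect_n n u -` ?C \<inter> space ?L" .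
  have "emeasure ?L (reflect_n n u -` ?C \<inter> space ?L) = emeasure (distr ?L ?L (reflect_n n u)) ?C"
    using C by (subst emeasure_distr) auto
  also have "\<dots> = emeasure ?L ?C" by (simp only: distr_lebesgue_n_reflect[OF n1])
  finally have cap: "emeasure (uniform_sphere n) (sphere_cap n v s) = emeasure ?L ?C / ennreal (unit_ball_vol (real n))"
    using emeasure_uniform_sphere[OF sphere_cap_sets[OF ve, of s]] eq
    by (simp add: emeasure_lebesgue_n_unit_ball)
  have "unit_ball_vol (real n) * ?p = h * ((unit_ball_vol (real n) * sqrt (real n / (2 * pi))) * sqrt (1 - (s + h)\<^sup>2) ^ (n - 1))"
    by simp
  also have "\<dots> \<le> h * (unit_ball_vol (real (n - 1)) * sqrt (1 - (s + h)\<^sup>2) ^ (n - 1))"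
    using h sq by (intro mult_left_mono mult_right_mono unit_ball_vol_ratio[OF n1]) auto
  finally have "ennreal (unit_ball_vol (real n) * ?p) \<le> emeasure ?L ?C"
    using emeasure_cone_axis[OF n s h sh] by (meson ennreal_leI order_trans)
  then have "ennreal (unit_ball_vol (real n) * ?p) / ennreal (unit_ball_vol (real n)) \<le> emeasure (uniform_sphere n) (sphere_cap n v s)"
    unfolding cap by (rule divide_right_mono_ennreal)
  also have "ennreal (unit_ball_vol (real n) * ?p) / ennreal (unit_ball_vol (real n)) = ennreal ?p"
  proof -
    have "ennreal (a * p) / ennreal a = ennreal p" if "a > 0" "p \<ge> 0" for a p :: real
      using that by (simp add: divide_ennreal)
    moreover have "unit_ball_vol (real n) > 0" by (rule unit_ball_vol_pos) simp
    moreover have "0 \<le> ?p" using h sq by (intro mult_nonneg_nonneg zero_le_power) auto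
    ultimately show ?thesis by blast
  qed
  finally show ?thesis by (simp add: emeasure_eq_measure)
qed

text \<open>
  Only the origin is projected off the sphere.
\<close>

lemma AE_uniform_sphere:
  assumes n: "n \<ge> 1"
  shows "AE x in uniform_sphere n. x \<in> unit_sphere n"
proof (rule AE_I)
  interpret P: product_sigma_finite "\<lambda>_::nat. lborel :: real measure" by standard
  let ?N = "space (lebesgue_n n) - unit_sphere n"
  have sp: "space (uniform_sphere n) = space (lebesgue_n n)"
    by (rule sets_eq_imp_space_eq) simp
  show "{x \<in> space (uniform_sphere n). x \<notin> unit_sphere n} \<subseteq> ?N"
    by (auto simp: sp)
  show N: "?N \<in> sets (uniform_sphere n)"
    by (simp add: sets.compl_sets)
  have "{x \<in> unit_ball n. radial_proj n x \<in> ?N} \<subseteq> (\<Pi>\<^sub>E i\<in>{..<n}. {0})"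
  proof
    fix x assume x: "x \<in> {x \<in> unit_ball n. radial_proj n x \<in> ?N}"
    have "radial_proj n x \<in> extensional {..<n}" by (simp add: radial_proj_def)
    with x have "norm_n n x = 0"
      using norm_n_radial_proj[of n x] by (auto simp: unit_sphere_def)
    then have "\<forall>i\<in>{..<n}. (x i)\<^sup>2 = 0"
      unfolding norm_n_def by (subst sum_nonneg_eq_0_iff[symmetric]) auto
    then show "x \<in> (\<Pi>\<^sub>E i\<in>{..<n}. {0})"
      using x by (intro PiE_I) (auto simp: unit_ball_def extensional_def)
  qed
  then have "emeasure (lebesgue_n n) {x \<in> unit_ball n. radial_proj n x \<in> ?N} \<le> emeasure (lebesgue_n n) (\<Pi>\<^sub>E i\<in>{..<n}. {0})"
    by (rule emeasure_mono) (intro sets_PiM_I_finite, simp_all)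
  also have "\<dots> = 0"
    using n by (subst P.emeasure_PiM) auto
  finally show "emeasure (uniform_sphere n) ?N = 0"
    using N by (subst emeasure_uniform_sphere) auto
qed

section \<open>Finite nets of the sphere\<close>

lemma unit_sphere_coord_le:
  assumes "x \<in> unit_sphere n" "i < n"
  shows "\<bar>x i\<bar> \<le> 1"
proof -
  have "(x i)\<^sup>2 \<le> (\<Sum>i<n. (x i)\<^sup>2)" using assms(2) by (intro member_le_sum) auto
  also have "\<dots> = 1" using assms(1) by (simp add: unit_sphere_def norm_n_def)
  finally show ?thesis by (simp add: abs_square_le_1)
qed

definition sphere_net :: "nat \<Rightarrow> real \<Rightarrow> (nat \<Rightarrow> real) set \<Rightarrow> bool" where
  "sphere_net n \<eta> N \<longleftrightarrow> finite N \<and> N \<subseteq> unit_sphere n \<and>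
     (\<forall>x\<in>unit_sphere n. \<exists>y\<in>N. norm_n n (minus_n n x y) \<le> \<eta>)"

text \<open>
  Points whose coordinates lie in the same cells of a grid of mesh \<open>1 / M\<close> are within
  \<open>sqrt n / M\<close> of each other, so one point of the sphere from each non-empty cell suffices.
\<close>

lemma sphere_net_exists:
  assumes M: "M \<ge> (1::nat)"
  shows "\<exists>N. sphere_net n (sqrt (real n) / real M) N \<and> card N \<le> (2 * M + 1) ^ n"
proof -
  define f where "f x = (\<lambda>i\<in>{..<n}. \<lfloor>real M * x i\<rfloor>)" for x :: "nat \<Rightarrow> real"
  define N where "N = inv_into (unit_sphere n) f ` (f ` unit_sphere n)"
  have "f ` unit_sphere n \<subseteq> (\<Pi>\<^sub>E i\<in>{..<n}. {- int M..int M})"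
  proof
    fix g assume "g \<in> f ` unit_sphere n"
    then obtain x where x: "x \<in> unit_sphere n" and g: "g = f x" by blast
    show "g \<in> (\<Pi>\<^sub>E i\<in>{..<n}. {- int M..int M})"
    proof (rule PiE_I)
      fix i assume i: "i \<in> {..<n}"
      have "\<bar>real M * x i\<bar> \<le> real M"
        using mult_left_mono[OF unit_sphere_coord_le[OF x, of i], of "real M"] i by (simp add: abs_mult)
      then show "g i \<in> {- int M..int M}" using i by (simp add: g f_def) linarith
    qed (simp add: g f_def)
  qed
  moreover have P: "finite (\<Pi>\<^sub>E i\<in>{..<n}. {- int M..int M})" "card (\<Pi>\<^sub>E i\<in>{..<n}. {- int M..int M}) = (2 * M + 1) ^ n"
    by (auto intro: finite_PiE simp: card_PiE nat_add_distrib nat_mult_distrib)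
  ultimately have fin: "finite (f ` unit_sphere n)" and card: "card (f ` unit_sphere n) \<le> (2 * M + 1) ^ n"
    using finite_subset card_mono by (blast, metis)
  have "card N \<le> (2 * M + 1) ^ n"
    using card_image_le[OF fin, of "inv_into (unit_sphere n) f"] card by (simp add: N_def)
  moreover have "sphere_net n (sqrt (real n) / real M) N"
    unfolding sphere_net_def
  proof (intro conjI ballI)
    show "finite N" using fin by (simp add: N_def)
    show "N \<subseteq> unit_sphere n" by (auto simp: N_def intro: inv_into_into)
    fix x assume x: "x \<in> unit_sphere n"
    define y where "y = inv_into (unit_sphere n) f (f x)"
    have y: "y \<in> N" using x by (auto simp: N_def y_def)
    have fy: "f y = f x" using x by (simp add: y_def f_inv_into_f)
    have "norm_n n (minus_n n x y) \<le> sqrt (\<Sum>i<n. (1 / real M)\<^sup>2)"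
      unfolding norm_n_def
    proof (intro real_sqrt_le_mono sum_mono)
      fix i assume i: "i \<in> {..<n}"
      have "\<lfloor>real M * x i\<rfloor> = \<lfloor>real M * y i\<rfloor>" using fun_cong[OF fy, of i] i by (simp add: f_def)
      then have "\<bar>real M * x i - real M * y i\<bar> \<le> 1" by linarith
      then have "real M * \<bar>x i - y i\<bar> \<le> 1" using abs_mult[of "real M" "x i - y i"] by (simp add: right_diff_distrib)
      then have "\<bar>minus_n n x y i\<bar> \<le> 1 / real M" using M i by (simp add: minus_n_apply field_simps)
      then show "(minus_n n x y i)\<^sup>2 \<le> (1 / real M)\<^sup>2" by (simp add: abs_le_square_iff[symmetric])
    qed
    also have "\<dots> = sqrt (real n) / real M"
      using M by (simp add: real_sqrt_divide power_divide real_sqrt_mult)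
    finally show "\<exists>y\<in>N. norm_n n (minus_n n x y) \<le> sqrt (real n) / real M" using y by blast
  qed
  ultimately show ?thesis by blast
qed

section \<open>The hitting event\<close>

lemma image_in_hitting_sets_iff:
  "z ` {1..t} \<in> hitting_sets n \<tau> t \<longleftrightarrow>
    (\<forall>i\<in>{1..t}. z i \<in> unit_sphere n) \<and> (\<forall>x\<in>unit_sphere n. \<exists>i\<in>{1..t}. \<tau> \<le> inner_n n x (z i))"
proof -
  have "card (z ` {1..t}) \<le> t" using card_image_le[of "{1..t}" z] by simp
  then show ?thesis
    unfolding hitting_sets_def hitting_set_def sphere_cap_def by auto
qed

lemma inner_n_perturb:
  assumes "z \<in> unit_sphere n"
  shows "inner_n n y z \<le> inner_n n x z + norm_n n (minus_n n x y)"
proof -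
  have "\<bar>inner_n n (minus_n n x y) z\<bar> \<le> norm_n n (minus_n n x y) * 1"
    using inner_n_le_norm_n[of n "minus_n n x y" z] assms by (simp add: unit_sphere_def)
  then show ?thesis by (simp add: inner_n_minus_left)
qed

text \<open>
  A countable dense set replaces the sphere in the hitting event, to reduce it to countably many
  conditions.
\<close>

lemma countable_dense_in_sphere:
  obtains D where "countable D" "D \<subseteq> unit_sphere n"
    "\<And>x \<eta>. x \<in> unit_sphere n \<Longrightarrow> \<eta> > 0 \<Longrightarrow> \<exists>y\<in>D. norm_n n (minus_n n x y) < \<eta>"
proof -
  have "\<forall>k. \<exists>N. sphere_net n (sqrt (real n) / real (Suc k)) N"
    using sphere_net_exists[of "Suc _" n] by auto
  then obtain N where N: "\<And>k. sphere_net n (sqrt (real n) / real (Suc k)) (N k)"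
    by metis
  show thesis
  proof
    show "countable (\<Union>k. N k)" using N by (intro countable_UN) (auto simp: sphere_net_def countable_finite)
    show "(\<Union>k. N k) \<subseteq> unit_sphere n" using N by (auto simp: sphere_net_def)
    fix x and \<eta> :: real assume x: "x \<in> unit_sphere n" and \<eta>: "\<eta> > 0"
    obtain k where k: "sqrt (real n) / \<eta> < real k" using reals_Archimedean2 by blast
    then have "sqrt (real n) / real (Suc k) < \<eta>" using \<eta> by (simp add: field_simps)
    moreover obtain y where "y \<in> N k" "norm_n n (minus_n n x y) \<le> sqrt (real n) / real (Suc k)"
      using N[of k] x by (auto simp: sphere_net_def)
    ultimately show "\<exists>y\<in>(\<Union>k. N k). norm_n n (minus_n n x y) < \<eta>" by (intro bexI[of _ y]) auto
  qed
qed

text \<open>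
  The event quantifies over uncountably many points \<open>x\<close>. For a finite sample, however, the largest
  product of \<open>x\<close> with a sample point depends continuously on \<open>x\<close>, so that it is enough to test the
  points of a countable dense set.
\<close>

lemma hitting_event_measurable:
  "{z \<in> space (iid_uniform n t). z ` {1..t} \<in> hitting_sets n \<tau> t} \<in> sets (iid_uniform n t)"
proof -
  obtain D where D: "countable D" "D \<subseteq> unit_sphere n"
    and dense: "\<And>x \<eta>. x \<in> unit_sphere n \<Longrightarrow> \<eta> > 0 \<Longrightarrow> \<exists>y\<in>D. norm_n n (minus_n n x y) < \<eta>"
    using countable_dense_in_sphere[of n] by blast
  let ?I = "iid_uniform n t"
  have comp: "(\<lambda>z. z i) \<in> measurable ?I (lebesgue_n n)" if "i \<in> {1..t}" for i
    using measurable_component_singleton[OF that, of "\<lambda>_. uniform_sphere n"]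
    unfolding iid_uniform_def by (simp cong: measurable_cong_sets)
  have "(\<forall>x\<in>unit_sphere n. \<exists>i\<in>{1..t}. \<tau> \<le> inner_n n x (z i)) \<longleftrightarrow> (\<forall>x\<in>D. \<exists>i\<in>{1..t}. \<tau> \<le> inner_n n x (z i))"
    if z: "\<forall>i\<in>{1..t}. z i \<in> unit_sphere n" for z
  proof
    assume *: "\<forall>x\<in>D. \<exists>i\<in>{1..t}. \<tau> \<le> inner_n n x (z i)"
    show "\<forall>x\<in>unit_sphere n. \<exists>i\<in>{1..t}. \<tau> \<le> inner_n n x (z i)"
    proof (rule ccontr, clarsimp simp: not_le)
      fix x assume x: "x \<in> unit_sphere n" and lt: "\<forall>i\<in>{Suc 0..t}. inner_n n x (z i) < \<tau>"
      (* inserting a value below the threshold makes the maximum defined for an empty sample *)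
      define m where "m = Max (insert (\<tau> - 1) ((\<lambda>i. inner_n n x (z i)) ` {1..t}))"
      have "m < \<tau>" using lt by (auto simp: m_def)
      then obtain y where y: "y \<in> D" "norm_n n (minus_n n x y) < \<tau> - m"
        using dense[OF x, of "\<tau> - m"] by auto
      from * y obtain i where i: "i \<in> {1..t}" "\<tau> \<le> inner_n n y (z i)" by blast
      have "inner_n n x (z i) \<le> m" unfolding m_def by (rule Max_ge) (use i in auto)
      moreover have "inner_n n y (z i) \<le> inner_n n x (z i) + norm_n n (minus_n n x y)"
        using z i by (intro inner_n_perturb) auto
      ultimately show False using y i by linarith
    qed
  qed (use D in blast)
  then have "z ` {1..t} \<in> hitting_sets n \<tau> t \<longleftrightarrow>
      (\<forall>i\<in>{1..t}. z i \<in> unit_sphere n) \<and> \<not> (\<exists>x\<in>D. \<forall>i\<in>{1..t}. inner_n n x (z i) < \<tau>)" for z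
    by (simp only: image_in_hitting_sets_iff not_le[symmetric] cong: conj_cong) blast
  then have "{z \<in> space ?I. z ` {1..t} \<in> hitting_sets n \<tau> t}
    = {z \<in> space ?I. \<forall>i\<in>{1..t}. z i \<in> unit_sphere n}
      - (\<Union>x\<in>D. {z \<in> space ?I. \<forall>i\<in>{1..t}. inner_n n x (z i) < \<tau>})"
    by (auto simp del: One_nat_def ball_simps bex_simps atLeastAtMost_iff)
  also have "\<dots> \<in> sets ?I"
  proof (intro sets.Diff sets.countable_UN' image_subsetI D(1) sets.sets_Collect_finite_All)
    show "{z \<in> space ?I. z i \<in> unit_sphere n} \<in> sets ?I" if "i \<in> {1..t}" for i
      using measurable_sets[OF comp[OF that] unit_sphere_sets] by (simp add: vimage_def Int_def conj_commute)
    show "{z \<in> space ?I. inner_n n x (z i) < \<tau>} \<in> sets ?I" if "x \<in> D" "i \<in> {1..t}" for x i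
    proof -
      have "x \<in> space (lebesgue_n n)" using that D by (auto simp: unit_sphere_def space_lebesgue_n)
      then show ?thesis
        by (intro borel_measurable_less borel_measurable_const inner_n_measurable comp measurable_const that)
    qed
  qed auto
  finally show ?thesis .
qed

lemma prob_all_miss_le:
  assumes n: "n \<ge> 1" and C: "C \<in> sets (lebesgue_n n)" and p: "p \<le> measure (uniform_sphere n) C"
  shows "{z \<in> space (iid_uniform n t). \<forall>i\<in>{1..t}. z i \<notin> C} \<in> sets (iid_uniform n t)" (is "?A \<in> _")
    and "measure (iid_uniform n t) {z \<in> space (iid_uniform n t). \<forall>i\<in>{1..t}. z i \<notin> C} \<le> exp (- p * real t)"
proof -
  let ?U = "uniform_sphere n"
  interpret U: prob_space ?U using n by (rule prob_space_uniform_sphere)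
  interpret F: finite_product_prob_space "\<lambda>_::nat. ?U" "{1..t}" by unfold_locales auto
  have eq: "?A = (\<Pi>\<^sub>E i\<in>{1..t}. space ?U - C)"
    by (rule set_eqI) (simp add: iid_uniform_def space_PiM PiE_iff, blast)
  have C': "space ?U - C \<in> sets ?U" using C by (intro sets.compl_sets) simp
  show "?A \<in> sets (iid_uniform n t)"
    unfolding eq unfolding iid_uniform_def using C' by (intro sets_PiM_I_finite) auto
  have "measure (iid_uniform n t) ?A = (\<Prod>i\<in>{1..t}. measure ?U (space ?U - C))"
    unfolding eq unfolding iid_uniform_def using C' by (intro F.prob_times) auto
  also have "\<dots> = (1 - measure ?U C) ^ t"
    using C by (simp add: U.prob_compl)
  also have "\<dots> \<le> exp (- p) ^ t"
  proof (rule power_mono)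
    have "1 - measure ?U C \<le> exp (- measure ?U C)" using exp_ge_add_one_self[of "- measure ?U C"] by simp
    also have "\<dots> \<le> exp (- p)" using p by simp
    finally show "1 - measure ?U C \<le> exp (- p)" .
  qed simp
  also have "\<dots> = exp (- p * real t)" by (simp add: exp_of_nat_mult[symmetric] mult.commute)
  finally show "measure (iid_uniform n t) ?A \<le> exp (- p * real t)" .
qed

text \<open>
  The union bound. If every point \<open>x\<close> of the net has a sample point with product at least \<open>\<tau> + \<eta>\<close>,
  then every point of the sphere has one with product at least \<open>\<tau>\<close>, because moving \<open>x\<close> by \<open>\<eta>\<close>
  changes the product with a unit vector by at most \<open>\<eta>\<close>. The sample points are on the sphere only
  almost surely, whence the comparison of events up to null sets.
\<close>

lemma prob_hitting_ge:
  assumes n: "n \<ge> 1" and N: "sphere_net n \<eta> N"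
    and p: "\<And>x. x \<in> N \<Longrightarrow> p \<le> measure (uniform_sphere n) (sphere_cap n x (\<tau> + \<eta>))"
  shows "measure (iid_uniform n t) {z \<in> space (iid_uniform n t). z ` {1..t} \<in> hitting_sets n \<tau> t}
    \<ge> 1 - real (card N) * exp (- p * real t)"
proof -
  let ?I = "iid_uniform n t" and ?E = "{z \<in> space (iid_uniform n t). z ` {1..t} \<in> hitting_sets n \<tau> t}"
  have U: "prob_space (uniform_sphere n)" using n by (rule prob_space_uniform_sphere)
  interpret prob_space ?I
    unfolding iid_uniform_def using U by (intro prob_space_PiM)
  define A where "A x = {z \<in> space ?I. \<forall>i\<in>{1..t}. z i \<notin> sphere_cap n x (\<tau> + \<eta>)}" for x
  have fin: "finite N" and sub: "N \<subseteq> unit_sphere n" using N by (auto simp: sphere_net_def)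
  have cap: "sphere_cap n x (\<tau> + \<eta>) \<in> sets (lebesgue_n n)" if "x \<in> N" for x
    using that sub by (intro sphere_cap_sets) (auto simp: unit_sphere_def)
  have A: "A x \<in> sets ?I" "measure ?I (A x) \<le> exp (- p * real t)" if "x \<in> N" for x
    unfolding A_def using prob_all_miss_le[OF n cap[OF that] p[OF that]] by auto
  have "AE z in ?I. \<forall>i\<in>{1..t}. z i \<in> unit_sphere n"
    unfolding iid_uniform_def using AE_uniform_sphere[OF n] U
    by (intro AE_finite_allI AE_PiM_component) auto
  then have "AE z in ?I. z \<in> space ?I - ?E \<longrightarrow> z \<in> (\<Union>x\<in>N. A x)"
  proof (eventually_elim, intro impI)
    fix z assume z: "\<forall>i\<in>{1..t}. z i \<in> unit_sphere n" and zE: "z \<in> space ?I - ?E"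
    from z zE have "\<not> (\<forall>y\<in>unit_sphere n. \<exists>i\<in>{1..t}. \<tau> \<le> inner_n n y (z i))"
      unfolding image_in_hitting_sets_iff by blast
    then obtain y where y: "y \<in> unit_sphere n" "\<forall>i\<in>{1..t}. inner_n n y (z i) < \<tau>"
      by (meson not_le)
    obtain x where x: "x \<in> N" "norm_n n (minus_n n y x) \<le> \<eta>"
      using N y by (auto simp: sphere_net_def)
    have "inner_n n x (z i) < \<tau> + \<eta>" if "i \<in> {1..t}" for i
      using inner_n_perturb[of "z i" n x y] x y z that by fastforce
    then have "z \<in> A x" using zE by (fastforce simp: A_def sphere_cap_def inner_n_commute)
    with x show "z \<in> (\<Union>x\<in>N. A x)" by blast
  qed
  then have "measure ?I (space ?I - ?E) \<le> measure ?I (\<Union>x\<in>N. A x)"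
    using A fin by (intro finite_measure_mono_AE sets.finite_UN) auto
  also have "\<dots> \<le> (\<Sum>x\<in>N. measure ?I (A x))"
    using A fin by (intro finite_measure_subadditive_finite) auto
  also have "\<dots> \<le> (\<Sum>x\<in>N. exp (- p * real t))"
    by (intro sum_mono A)
  finally show ?thesis
    using prob_compl[OF hitting_event_measurable[of n t \<tau>]] by simp
qed

section \<open>The constants\<close>

lemma sqrt_one_minus_ge:
  fixes w :: real
  assumes "0 \<le> w" "w \<le> 3 / 4"
  shows "exp (- 2 * w) \<le> sqrt (1 - w)"
proof -
  have "1 / (1 - w) = 1 + w / (1 - w)" using assms by (simp add: field_simps)
  also have "\<dots> \<le> exp (w / (1 - w))" by (rule exp_ge_add_one_self)
  also have "w / (1 - w) \<le> w / (1 / 4)" using assms by (intro divide_left_mono) auto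
  then have "exp (w / (1 - w)) \<le> exp (4 * w)" by simp
  finally have "exp (- (4 * w)) \<le> 1 - w"
    using assms by (simp add: exp_minus field_simps)
  also have "exp (- (4 * w)) = (exp (- 2 * w))\<^sup>2" by (simp add: power2_eq_square exp_add[symmetric])
  finally show ?thesis by (rule real_le_rsqrt)
qed

text \<open>
  The cap lies at height \<open>s = \<tau> + h\<close> and the cylinder above it has height \<open>h\<close>, where
  \<open>h = 1 / (10 * sqrt n)\<close>. By the ratio of ball volumes the factor in front is bounded below, and
  with \<open>w = (s + h)\<^sup>2\<close> the remaining factor is at least \<open>exp (- 2 * w * n)\<close>. Two bounds on \<open>w\<close> are needed, both of
  the form \<open>(a + b)\<^sup>2 \<le> (1 + \<theta>) * a\<^sup>2 + (1 + 1 / \<theta>) * b\<^sup>2\<close>: with \<open>\<theta> = 1/5\<close> it stays away from \<open>1\<close>, where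
  the hypothesis on \<open>\<gamma>\<close> enters as \<open>\<tau>\<^sup>2 \<le> 1/2\<close>; with \<open>\<theta> = 1\<close> one gets
  \<open>w * n \<le> \<gamma> * ln n + 2/25\<close>, which yields the exponent \<open>- 2 * \<gamma>\<close>.
\<close>

lemma measure_sphere_cap_threshold_ge:
  assumes n: "n \<ge> 2" and \<gamma>: "\<gamma> > 0" "\<gamma> * ln (real n) < real n" and v: "v \<in> unit_sphere n"
  shows "measure (uniform_sphere n)
      (sphere_cap n v (sqrt (\<gamma> * ln (real n) / (2 * real n)) + 1 / (10 * sqrt (real n))))
    \<ge> real n powr (- 2 * \<gamma>) / 60"
proof -
  define \<tau> where "\<tau> = sqrt (\<gamma> * ln (real n) / (2 * real n))"
  define h where "h = 1 / (10 * sqrt (real n))"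
  define w where "w = (\<tau> + h + h)\<^sup>2"
  have ln0: "ln (real n) > 0" using n by simp
  have h: "h > 0" "h\<^sup>2 = 1 / (100 * real n)" using n by (auto simp: h_def power_divide power_mult_distrib)
  have \<tau>: "\<tau> \<ge> 0" "\<tau>\<^sup>2 = \<gamma> * ln (real n) / (2 * real n)" using n \<gamma> ln0 by (auto simp: \<tau>_def)
  have "\<tau>\<^sup>2 \<le> 1 / 2" using \<gamma> n by (simp add: \<tau> field_simps)
  moreover have "h\<^sup>2 \<le> 1 / 200" using n by (simp add: h field_simps)
  moreover have "w \<le> 6 / 5 * \<tau>\<^sup>2 + 24 * h\<^sup>2"
    using zero_le_power2[of "\<tau> - 10 * h"] by (simp add: w_def power2_eq_square algebra_simps)
  ultimately have w34: "w \<le> 3 / 4" by linarith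
  have "w \<le> 2 * \<tau>\<^sup>2 + 8 * h\<^sup>2"
    using zero_le_power2[of "\<tau> - 2 * h"] by (simp add: w_def power2_eq_square algebra_simps)
  then have wn: "w * real n \<le> \<gamma> * ln (real n) + 2 / 25"
    using n by (simp add: \<tau> h field_simps)
  have sh: "\<tau> + h + h < 1"
  proof (rule power2_less_imp_less)
    show "(\<tau> + h + h)\<^sup>2 < 1\<^sup>2" using w34 by (simp add: w_def)
  qed simp
  have c: "1 / 30 \<le> h * sqrt (real n / (2 * pi))"
  proof -
    have "sqrt (2 * pi) \<le> sqrt (3\<^sup>2)" using pi_less_4 pi_approx by (intro real_sqrt_le_mono) (simp add: power2_eq_square)
    then have "sqrt (2 * pi) \<le> 3" by simp
    then have "1 / (10 * 3) \<le> 1 / (10 * sqrt (2 * pi))" by (intro divide_left_mono) auto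
    also have "\<dots> = h * sqrt (real n / (2 * pi))" using n by (simp add: h_def real_sqrt_divide)
    finally show ?thesis by simp
  qed
  have "real n powr (- 2 * \<gamma>) / 2 \<le> exp (- 2 * \<gamma> * ln (real n)) * exp (- (4 / 25))"
    using exp_ge_add_one_self[of "- (4 / 25)"] n by (simp add: powr_def)
  also have "\<dots> = exp (- 2 * (\<gamma> * ln (real n) + 2 / 25))" by (simp add: exp_add[symmetric])
  also have "\<dots> \<le> exp (- 2 * (w * real n))" using wn by simp
  also have "\<dots> = exp (- 2 * w) ^ n" by (simp add: exp_of_nat_mult[symmetric] mult_ac)
  also have "\<dots> \<le> sqrt (1 - w) ^ n"
    using w34 by (intro power_mono sqrt_one_minus_ge) (auto simp: w_def)
  also have "\<dots> \<le> sqrt (1 - w) ^ (n - 1)"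
    using w34 by (intro power_decreasing) (auto simp: w_def)
  finally have "1 / 30 * (real n powr (- 2 * \<gamma>) / 2) \<le> h * sqrt (real n / (2 * pi)) * sqrt (1 - w) ^ (n - 1)"
    using c h by (intro mult_mono) auto
  also have "\<dots> \<le> measure (uniform_sphere n) (sphere_cap n v (\<tau> + h))"
    unfolding w_def using \<tau> h sh n v by (intro measure_sphere_cap_ge) auto
  finally show ?thesis by (simp add: \<tau>_def h_def)
qed

text \<open>
  The grid with \<open>M = 10 * n\<close>, whose cells have diameter \<open>1 / (10 * sqrt n)\<close>.
\<close>

lemma grid_count_le:
  assumes "n \<ge> 2"
  shows "real ((2 * (10 * n) + 1) ^ n) \<le> exp (6 * (real n * ln (real n)))"
proof -
  have "2 ^ 5 \<le> n ^ 5" using assms by (intro power_mono) auto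
  then have "32 * n \<le> n ^ 5 * n" by (intro mult_right_mono) auto
  also have "n ^ 5 * n = n ^ 6" by (simp add: eval_nat_numeral)
  finally have "2 * (10 * n) + 1 \<le> n ^ 6" using assms by linarith
  then have "(2 * (10 * n) + 1) ^ n \<le> (n ^ 6) ^ n" by (intro power_mono) auto
  then have "real ((2 * (10 * n) + 1) ^ n) \<le> real n ^ (6 * n)"
    unfolding power_mult[symmetric] by (metis of_nat_le_iff of_nat_power)
  also have "\<dots> = exp (real (6 * n) * ln (real n))"
    using assms by (subst exp_of_nat_mult) simp
  finally show ?thesis by (simp add: mult.assoc)
qed

section \<open>The random hitting set\<close>

theorem theorem2p2:
  shows "\<forall>\<gamma>>0::real. \<exists>\<kappa>>0::real. \<forall>n\<ge>2::nat. \<forall>\<epsilon>>0::real.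
    \<gamma> < real n / ln (real n) \<longrightarrow>
    (let t = sample_size \<kappa> \<gamma> n \<epsilon>
     in measure (iid_uniform n t)
          {z \<in> space (iid_uniform n t).
             z ` {1..t} \<in> hitting_sets n (sqrt (\<gamma> * ln (real n) / (2 * real n))) t}
        \<ge> 1 - \<epsilon>)"
proof (intro allI impI)
  fix \<gamma> :: real assume \<gamma>: "\<gamma> > 0"
  show "\<exists>\<kappa>>0::real. \<forall>n\<ge>2::nat. \<forall>\<epsilon>>0::real.
    \<gamma> < real n / ln (real n) \<longrightarrow>
    (let t = sample_size \<kappa> \<gamma> n \<epsilon>
     in measure (iid_uniform n t)
          {z \<in> space (iid_uniform n t).
             z ` {1..t} \<in> hitting_sets n (sqrt (\<gamma> * ln (real n) / (2 * real n))) t}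
        \<ge> 1 - \<epsilon>)"
  proof (intro exI[of _ 720] conjI allI impI, simp)
    fix n :: nat and \<epsilon> :: real
    (* 720 = 60 * 6 * 2: the reciprocal of the constant in the cap bound, the exponent 6 in the
       size of the net, and sqrt (ln n) >= 1/2 *)
    assume n: "n \<ge> 2" and \<epsilon>: "\<epsilon> > 0" and \<gamma>n: "\<gamma> < real n / ln (real n)"
    define t where "t = sample_size 720 \<gamma> n \<epsilon>"
    define \<tau> where "\<tau> = sqrt (\<gamma> * ln (real n) / (2 * real n))"
    let ?P = "measure (iid_uniform n t) {z \<in> space (iid_uniform n t). z ` {1..t} \<in> hitting_sets n \<tau> t}"
    have "?P \<ge> 1 - \<epsilon>"
    proof (cases "\<epsilon> \<ge> 1")
      case True
      have "0 \<le> ?P" by (rule measure_nonneg)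
      with True show ?thesis by linarith
    next
      case False
      define L where "L = ln (1 / \<epsilon>)"
      define p where "p = real n powr (- 2 * \<gamma>) / 60"
      have L: "L \<ge> 0" "exp (- L) = \<epsilon>" using \<epsilon> False by (auto simp: L_def ln_div)
      have ln0: "ln (real n) > 0" using n by simp
      have \<gamma>n': "\<gamma> * ln (real n) < real n" using \<gamma>n ln0 by (simp add: pos_less_divide_eq)
      obtain N where N: "sphere_net n (sqrt (real n) / real (10 * n)) N" "card N \<le> (2 * (10 * n) + 1) ^ n"
        using sphere_net_exists[of "10 * n" n] n by auto
      have eta: "sqrt (real n) / real (10 * n) = 1 / (10 * sqrt (real n))"
        using n by (simp add: field_simps)
      have sub: "N \<subseteq> unit_sphere n" using N by (simp add: sphere_net_def)
      have hit: "?P \<ge> 1 - real (card N) * exp (- p * real t)"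
      proof (rule prob_hitting_ge)
        show "n \<ge> 1" using n by simp
        show "sphere_net n (1 / (10 * sqrt (real n))) N" using N eta by simp
        show "p \<le> measure (uniform_sphere n) (sphere_cap n x (\<tau> + 1 / (10 * sqrt (real n))))" if "x \<in> N" for x
          unfolding p_def \<tau>_def using that sub n \<gamma> \<gamma>n' by (intro measure_sphere_cap_threshold_ge) auto
      qed
      define X where "X = real n * ln (real n) + L"
      have X: "X \<ge> 0" using n ln0 L by (simp add: X_def)
      have "1 / 2 \<le> sqrt (ln (real n))"
      proof -
        have "(1 / 2)\<^sup>2 \<le> ln (2 :: real)" using ln2_ge_two_thirds by (simp add: power2_eq_square)
        also have "\<dots> \<le> ln (real n)" using n by simp
        finally show ?thesis by (rule real_le_rsqrt)
      qed
      then have "6 * X \<le> 12 * (sqrt (ln (real n)) * X)"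
        using mult_right_mono[OF _ X, of "1 / 2" "sqrt (ln (real n))"] by (simp add: mult_ac)
      also have "\<dots> = p * (720 * real n powr (2 * \<gamma>) * sqrt (ln (real n)) * X)"
        using n by (simp add: p_def powr_minus field_simps)
      also have "\<dots> \<le> p * real t"
      proof (rule mult_left_mono)
        show "720 * real n powr (2 * \<gamma>) * sqrt (ln (real n)) * X \<le> real t"
          unfolding t_def sample_size_def X_def L_def by linarith
      qed (simp add: p_def)
      finally have pt: "6 * (real n * ln (real n)) + L \<le> p * real t" using L by (simp add: X_def)
      have "real (card N) \<le> exp (6 * (real n * ln (real n)))"
        using N(2) grid_count_le[OF n] by (meson of_nat_mono order_trans)
      then have "real (card N) * exp (- p * real t) \<le> exp (6 * (real n * ln (real n))) * exp (- p * real t)"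
        by (intro mult_right_mono) auto
      also have "\<dots> = exp (6 * (real n * ln (real n)) - p * real t)" by (simp add: exp_diff exp_minus field_simps)
      also have "\<dots> \<le> exp (- L)" using pt by simp
      finally show ?thesis using hit L by simp
    qed
    then show "let t = sample_size 720 \<gamma> n \<epsilon>
     in measure (iid_uniform n t)
          {z \<in> space (iid_uniform n t).
             z ` {1..t} \<in> hitting_sets n (sqrt (\<gamma> * ln (real n) / (2 * real n))) t}
        \<ge> 1 - \<epsilon>"
      by (simp add: Let_def t_def \<tau>_def)
  qed
qed

end
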